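(* The family $\mathcal{S}=\{T\in\mathrm{Tree}_2 : T\text{ contains (as a subset) a Sacks tree}\}$ is a $\mathbf{\Sigma}_1^1$-complete subset of $\mathrm{Tree}_2$.
   Context: A tree over $\{0,1\}$ is a set $T\subseteq 2^{<\omega}$ (finite $0$-$1$ sequences) closed under initial segments. $\mathrm{Tree}_2$ is the set of all such trees, a Polish space as a subspace of $\mathcal{P}(2^{<\omega})\cong 2^{2^{<\omega}}$ (product topology). A nonempty tree $T\in\mathrm{Tree}_2$ is a Sacks tree (perfect tree) if for every $\sigma\in T$ there is $\tau\in T$ with $\tau\supseteq\sigma$, $\tau^\frown 0\in T$ and $\tau^\frown 1\in T$. Completeness: for Polish spaces $\mathcal{X},\mathcal{Y}$ and $A\subseteq\mathcal{X}$, $B\subseteq\mathcal{Y}$, $B$ is Borel reducible to $A$ if there is a Borel function $f:\mathcal{Y}\to\mathcal{X}$ with $f^{-1}[A]=B$. $A\subseteq\mathcal{X}$ is $\mathbf{\Sigma}_1^1$-complete if $A$ is analytic and for every Polish space $\mathcal{Y}$ every analytic $B\subseteq\mathcal{Y}$ is Borel reducible to $A$. *)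

theory Defs
  imports "HOL-Analysis.Analysis" "HOL-Library.Sublist"
begin

section \<open>Polish spaces, analytic sets, Borel reducibility\<close>

text \<open>Counterpart of the type class \<^class>\<open>polish_space\<close> for abstract topologies: for metrizable
  spaces, second countable is the same as separable.\<close>

definition Polish_space :: "'a topology \<Rightarrow> bool" where
  "Polish_space X \<longleftrightarrow> completely_metrizable_space X \<and> second_countable X"

text \<open>A subset of a Polish space is analytic if it is the continuous image of some (possibly empty)
  Polish space. The existential quantifier has to range over topologies on one fixed type; since a
  Polish space has at most continuum many points, the type of functions from naturals to naturals
  is large enough to carry a copy of every Polish space. The lemma \<open>analytic_inI\<close> below shows that
  no generality is lost.\<close>

definition analytic_in :: "'a topology \<Rightarrow> 'a set \<Rightarrow> bool" where
  "analytic_in X A \<longleftrightarrow>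
     (\<exists>(Z :: (nat \<Rightarrow> nat) topology) f.
        Polish_space Z \<and> continuous_map Z X f \<and> f ` topspace Z = A)"

definition borel_algebra :: "'a topology \<Rightarrow> 'a measure" where
  "borel_algebra X = sigma (topspace X) {U. openin X U}"

definition Borel_reducible :: "'b topology \<Rightarrow> 'b set \<Rightarrow> 'a topology \<Rightarrow> 'a set \<Rightarrow> bool" where
  "Borel_reducible Y B X A \<longleftrightarrow>
     (\<exists>f \<in> measurable (borel_algebra Y) (borel_algebra X). f -` A \<inter> topspace Y = B)"

text \<open>HOL cannot quantify over types inside a formula, so the type of points of the spaces \<open>Y\<close> is a
  parameter. A theorem concluding \<open>Sigma11_complete TYPE('b) X A\<close> with \<open>'b\<close> a free type variable
  covers all Polish spaces \<open>Y\<close>.\<close>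

definition Sigma11_complete :: "'b itself \<Rightarrow> 'a topology \<Rightarrow> 'a set \<Rightarrow> bool" where
  "Sigma11_complete (_ :: 'b itself) X A \<longleftrightarrow>
     Polish_space X \<and> analytic_in X A \<and>
     (\<forall>(Y :: 'b topology) B. Polish_space Y \<and> analytic_in Y B \<longrightarrow> Borel_reducible Y B X A)"


section \<open>Trees\<close>

text \<open>Finite 0-1 sequences are Boolean lists, with \<^term>\<open>False\<close> for 0 and \<^term>\<open>True\<close> for 1.\<close>

definition tree :: "bool list set \<Rightarrow> bool" where
  "tree T \<longleftrightarrow> (\<forall>\<sigma>\<in>T. \<forall>\<tau>. prefix \<tau> \<sigma> \<longrightarrow> \<tau> \<in> T)"

definition Sacks_tree :: "bool list set \<Rightarrow> bool" where
  "Sacks_tree T \<longleftrightarrow> tree T \<and> T \<noteq> {} \<and>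
     (\<forall>\<sigma>\<in>T. \<exists>\<tau>\<in>T. prefix \<sigma> \<tau> \<and> \<tau> @ [False] \<in> T \<and> \<tau> @ [True] \<in> T)"

text \<open>The topology on a power set that is transported from the product of discrete two-point spaces
  by identifying a set with its characteristic function.\<close>

definition powerset_topology :: "'a set topology" where
  "powerset_topology =
     pullback_topology UNIV (\<lambda>S x. x \<in> S) (product_topology (\<lambda>_. discrete_topology UNIV) UNIV)"

definition Tree2 :: "bool list set topology" where
  "Tree2 = subtopology powerset_topology {T. tree T}"


section \<open>Sanity checks\<close>

lemma topspace_Tree2: "topspace Tree2 = {T. tree T}"
  by (simp add: Tree2_def powerset_topology_def topspace_pullback_topology)

lemma analytic_inI:
  fixes Z :: "'c topology" and X :: "'a topology"
  assumes Z: "Polish_space Z" and f: "continuous_map Z X f"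
  shows "analytic_in X (f ` topspace Z)"
proof -
  have m: "metrizable_space Z"
    using Z by (simp add: Polish_space_def completely_metrizable_imp_metrizable_space)
  have "second_countable Z" using Z by (simp add: Polish_space_def)
  then obtain \<B> where B: "countable \<B> \<and> (\<forall>V\<in>\<B>. openin Z V) \<and>
      (\<forall>U x. openin Z U \<and> x \<in> U \<longrightarrow> (\<exists>V\<in>\<B>. x \<in> V \<and> V \<subseteq> U))"
    unfolding second_countable_def by (rule exE)
  have cB: "countable \<B>" using B by (rule conjunct1)
  have nb: "\<exists>V\<in>\<B>. x \<in> V \<and> V \<subseteq> U" if "openin Z U" "x \<in> U" for U x
    using B that by simp
  define g where
    "g = (\<lambda>z (n::nat). if n \<in> to_nat_on \<B> ` {V\<in>\<B>. z \<in> V} then 1 else (0::nat))"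
  have g1: "g z (to_nat_on \<B> V) = 1 \<longleftrightarrow> z \<in> V" if "V \<in> \<B>" for z V
  proof -
    have "to_nat_on \<B> V \<in> to_nat_on \<B> ` {W\<in>\<B>. z \<in> W} \<longleftrightarrow> V \<in> {W\<in>\<B>. z \<in> W}"
      by (rule inj_on_image_mem_iff[OF inj_on_to_nat_on[OF cB] that]) blast
    then show ?thesis using that unfolding g_def by simp
  qed
  have sep: "x = y" if x: "x \<in> topspace Z" and y: "y \<in> topspace Z" and eq: "g x = g y" for x y
  proof (rule ccontr)
    assume "x \<noteq> y"
    then obtain U where U: "openin Z U" "x \<in> U" "y \<notin> U"
      using metrizable_imp_Hausdorff_space[OF m] x y unfolding Hausdorff_space_def disjnt_iff
      by blast
    then obtain V where V: "V \<in> \<B>" "x \<in> V" "V \<subseteq> U" using nb by blast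
    have "g x (to_nat_on \<B> V) = 1" using g1[OF V(1)] V(2) by simp
    then have "g y (to_nat_on \<B> V) = 1" using eq by simp
    then have "y \<in> V" using g1[OF V(1)] by simp
    then show False using V U by blast
  qed
  then have inj: "inj_on g (topspace Z)" by (auto simp: inj_on_def)
  define h where "h = inv_into (topspace Z) g"
  define Z' where "Z' = pullback_topology (g ` topspace Z) h Z"
  have hg: "h (g z) = z" if "z \<in> topspace Z" for z
    using that inj by (simp add: h_def)
  have ts: "topspace Z' = g ` topspace Z"
    by (auto simp: Z'_def topspace_pullback_topology hg)
  have ch: "continuous_map Z' Z h"
    unfolding Z'_def using continuous_map_pullback[OF continuous_map_id] by simp
  have cg: "continuous_map Z Z' g"
    unfolding Z'_def
  proof (rule continuous_map_pullback')
    show "continuous_map Z Z (h \<circ> g)"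
      by (rule continuous_map_eq[OF continuous_map_id]) (simp add: hg)
    show "topspace Z \<subseteq> g -` g ` topspace Z" by blast
  qed
  have "homeomorphic_maps Z Z' g h"
    using ch cg by (auto simp: homeomorphic_maps_def ts hg)
  then have "Z homeomorphic_space Z'" by (auto simp: homeomorphic_space_def)
  then have "Polish_space Z'"
    using Z homeomorphic_completely_metrizable_space[of Z Z']
      homeomorphic_space_second_countability[of Z Z']
    by (simp add: Polish_space_def)
  moreover have "continuous_map Z' X (f \<circ> h)" using ch f by (rule continuous_map_compose)
  moreover have "(f \<circ> h) ` topspace Z' = f ` topspace Z"
    by (simp add: ts image_image hg)
  ultimately show ?thesis unfolding analytic_in_def by blast
qed

end

(* Pairs (S, T) of a Sacks tree S inside a tree T form a G-delta set, hence a Polish space, and its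
   second projection is analytic.

   For hardness, let B be the image of a continuous map f from a Polish space Z to Y. A sequence x of
   bits with infinitely many ones at places k0 < k1 < ... codes the point z of Z with
   d(z, q ki) <= 2^-i for all i, where q runs through a dense set and repeats each value infinitely
   often. Letting F s be the closure of the f-image of those z that satisfy the constraints in the
   finite sequence s, a point y lies in B iff the tree {s. y \<in> F s} has a branch with infinitely
   many ones. Insert a free bit after every one: the branches of the new tree with infinitely
   many ones come in perfect sets, while every Sacks tree has a branch with infinitely many ones. *)
theory Submission
  imports Defs
begin

subsection \<open>The topology of power sets\<close>

lemma topspace_powerset_topology [simp]: "topspace powerset_topology = UNIV"
  by (simp add: powerset_topology_def topspace_pullback_topology)

lemma continuous_map_into_powerset:
  assumes "\<And>x. continuous_map X (discrete_topology UNIV) (\<lambda>p. x \<in> f p)"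
  shows "continuous_map X powerset_topology f"
  unfolding powerset_topology_def
  by (rule continuous_map_pullback') (use assms in \<open>auto simp: continuous_map_componentwise_UNIV o_def\<close>)

lemma continuous_map_mem:
  "continuous_map powerset_topology (discrete_topology UNIV) (\<lambda>S. x \<in> S)"
proof -
  have "continuous_map powerset_topology (discrete_topology UNIV) ((\<lambda>p. p x) \<circ> (\<lambda>S x. x \<in> S))"
    unfolding powerset_topology_def
    by (intro continuous_map_pullback continuous_map_product_projection) simp
  then show ?thesis by (simp add: o_def)
qed

lemma openin_const: "openin powerset_topology {S. c}"
  using openin_topspace[of powerset_topology] by (cases c) auto

lemma openin_mem: "openin powerset_topology {S. x \<in> S}"
  using openin_continuous_map_preimage[OF continuous_map_mem, of "{True}" x] by simp

lemma openin_not_mem: "openin powerset_topology {S. x \<notin> S}"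
  using openin_continuous_map_preimage[OF continuous_map_mem, of "{False}" x] by simp

lemma openin_cylinder:
  assumes "finite D"
  shows "openin powerset_topology {T. T \<inter> D = E}"
proof (cases "E \<subseteq> D")
  case True
  have "{T. T \<inter> D = E} = topspace powerset_topology \<inter>
      \<Inter> ((\<lambda>x. if x \<in> E then {S. x \<in> S} else {S. x \<notin> S}) ` D)"
    using True by auto
  also have "openin powerset_topology \<dots>"
    using assms by (cases "D = {}") (auto simp: openin_mem openin_not_mem simp del: topspace_powerset_topology
        intro!: openin_Inter openin_Int)
  finally show ?thesis .
next
  case False
  then have "{T. T \<inter> D = E} = {}" by blast
  then show ?thesis by simp
qed

text \<open>A basic open box of the product restricts only finitely many coordinates;
  \<open>D\<close> collects them.\<close>

lemma cylinder_in_open: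
  assumes "openin powerset_topology U" "T \<in> U"
  obtains D where "finite D" "{T'. T' \<inter> D = T \<inter> D} \<subseteq> U"
proof -
  obtain V where V: "openin (product_topology (\<lambda>_. discrete_topology UNIV) UNIV) V"
    and U: "U = (\<lambda>S x. x \<in> S) -` V"
    using assms(1) unfolding powerset_topology_def openin_pullback_topology by auto
  then obtain W where W: "finite {i. W i \<noteq> UNIV}" "(\<lambda>x. x \<in> T) \<in> Pi\<^sub>E UNIV W" "Pi\<^sub>E UNIV W \<subseteq> V"
    using assms(2) unfolding openin_product_topology_alt by force
  show ?thesis
  proof (rule that[OF W(1)], rule subsetI)
    fix T' assume "T' \<in> {T'. T' \<inter> {i. W i \<noteq> UNIV} = T \<inter> {i. W i \<noteq> UNIV}}"
    then have *: "\<And>i. W i \<noteq> UNIV \<Longrightarrow> i \<in> T' \<longleftrightarrow> i \<in> T" by blast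
    have "(i \<in> T') \<in> W i" for i
      using W(2) *[of i] by (cases "W i = UNIV") (auto simp: PiE_iff)
    then show "T' \<in> U" using W(3) U by (auto simp: PiE_iff)
  qed
qed

lemma countable_cylinders:
  "countable ((\<lambda>(D, E). {T. T \<inter> D = E}) ` ({D::'a::countable set. finite D} \<times> {E. finite E}))"
  by (intro countable_image countable_SIGMA countable_Collect_finite)

text \<open>Characteristic functions give a homeomorphism with a countable product of discrete
  two-point spaces, which is completely metrizable. The cylinders over finite sets form a countable
  base.\<close>

lemma Polish_space_powerset: "Polish_space (powerset_topology :: 'a::countable set topology)"
proof -
  let ?P = "product_topology (\<lambda>_::'a. discrete_topology (UNIV::bool set)) UNIV"
  have "continuous_map powerset_topology ?P (\<lambda>S x. x \<in> S)"
    by (simp add: continuous_map_componentwise_UNIV continuous_map_mem)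
  moreover have "continuous_map ?P powerset_topology Collect"
    by (rule continuous_map_into_powerset)
      (use continuous_map_product_projection[of _ UNIV "\<lambda>_. discrete_topology UNIV"] in auto)
  ultimately have "homeomorphic_maps powerset_topology ?P (\<lambda>S x. x \<in> S) Collect"
    by (auto simp: homeomorphic_maps_def)
  then have "completely_metrizable_space (powerset_topology :: 'a set topology)"
    using homeomorphic_completely_metrizable_space homeomorphic_space_def
    by (metis (mono_tags, lifting) completely_metrizable_space_discrete_topology
        completely_metrizable_space_product_topology countableI_type)
  moreover have "second_countable (powerset_topology :: 'a set topology)"
  proof -
    let ?B = "(\<lambda>(D, E). {T. T \<inter> D = E}) ` ({D::'a set. finite D} \<times> {E. finite E})"
    have "\<forall>V\<in>?B. openin powerset_topology V"
      by (clarsimp simp: openin_cylinder)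
    moreover have "\<exists>V\<in>?B. T \<in> V \<and> V \<subseteq> U" if U: "openin powerset_topology U" "T \<in> U" for T U
    proof -
      obtain D where D: "finite D" "{T'. T' \<inter> D = T \<inter> D} \<subseteq> U"
        using cylinder_in_open[OF U] by blast
      then have "{T'. T' \<inter> D = T \<inter> D} \<in> ?B"
        by (intro image_eqI[of _ _ "(D, T \<inter> D)"]) simp_all
      then show ?thesis by (rule bexI[rotated]) (use D(2) in simp)
    qed
    ultimately show ?thesis
      unfolding second_countable_def using countable_cylinders by (intro exI[of _ ?B] conjI allI impI) auto
  qed
  ultimately show ?thesis by (simp add: Polish_space_def)
qed

section \<open>Polish subspaces and G-delta conditions\<close>

lemma Polish_space_gdelta:
  "Polish_space X \<Longrightarrow> gdelta_in X S \<Longrightarrow> Polish_space (subtopology X S)"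
  by (simp add: Polish_space_def completely_metrizable_space_gdelta_in second_countable_subtopology)

lemma gdelta_in_all:
  fixes \<phi> :: "'i::countable \<Rightarrow> 'a \<Rightarrow> bool"
  assumes "topspace X = UNIV" "\<And>i. gdelta_in X {p. \<phi> i p}"
  shows "gdelta_in X {p. \<forall>i. \<phi> i p}"
proof -
  have "{p. \<forall>i. \<phi> i p} = \<Inter> (range (\<lambda>i. {p. \<phi> i p}))" by auto
  then show ?thesis using assms(2) by (auto intro!: gdelta_in_Inter)
qed

lemma openin_ex:
  assumes "\<And>i. openin X {p. \<phi> i p}"
  shows "openin X {p. \<exists>i. \<phi> i p}"
proof -
  have "{p. \<exists>i. \<phi> i p} = \<Union> (range (\<lambda>i. {p. \<phi> i p}))" by auto
  then show ?thesis using assms by auto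
qed

lemma openin_disj: "openin X {p. P p} \<Longrightarrow> openin X {p. Q p} \<Longrightarrow> openin X {p. P p \<or> Q p}"
  using openin_Un[of X "{p. P p}" "{p. Q p}"] by (simp add: Un_def)

lemma openin_conj: "openin X {p. P p} \<Longrightarrow> openin X {p. Q p} \<Longrightarrow> openin X {p. P p \<and> Q p}"
  using openin_Int[of X "{p. P p}" "{p. Q p}"] by (simp add: Int_def)

lemma gdelta_in_conj: "gdelta_in X {p. P p} \<Longrightarrow> gdelta_in X {p. Q p} \<Longrightarrow> gdelta_in X {p. P p \<and> Q p}"
  using gdelta_in_Int[of X "{p. P p}" "{p. Q p}"] by (simp add: Int_def)

subsection \<open>Trees containing a Sacks tree form an analytic set\<close>

text \<open>A countable conjunction of open conditions on membership. The map \<open>g\<close>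
  allows use both for \<open>P\<close> itself (identity) and for either half of a subset of a sum
  type (\<open>Inl\<close>, \<open>Inr\<close>).\<close>

lemma gdelta_in_tree:
  fixes g :: "bool list \<Rightarrow> 'a"
  shows "gdelta_in powerset_topology {P. tree (g -` P)}"
proof -
  have "{P. tree (g -` P)} = {P. \<forall>\<sigma> \<tau>. g \<sigma> \<notin> P \<or> (\<not> prefix \<tau> \<sigma> \<or> g \<tau> \<in> P)}"
    by (auto simp: tree_def)
  moreover have "gdelta_in powerset_topology {P. g \<sigma> \<notin> P \<or> (\<not> prefix \<tau> \<sigma> \<or> g \<tau> \<in> P)}" for \<sigma> \<tau>
    by (intro open_imp_gdelta_in openin_disj openin_not_mem openin_mem openin_const)
  ultimately show ?thesis by (simp add: gdelta_in_all)
qed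

lemma gdelta_in_Sacks_tree:
  fixes g :: "bool list \<Rightarrow> 'a"
  shows "gdelta_in powerset_topology {P. Sacks_tree (g -` P)}"
proof -
  \<comment> \<open>This turns nonemptiness into a single membership. What remains, besides being a
    tree, is for each \<sigma> an open condition.\<close>
  have ne: "T \<noteq> {} \<longleftrightarrow> [] \<in> T" if "tree T" for T
    using that by (auto simp: tree_def)
  have "Sacks_tree (g -` P) \<longleftrightarrow> tree (g -` P) \<and> g [] \<in> P \<and>
     (\<forall>\<sigma>. g \<sigma> \<notin> P \<or> (\<exists>\<tau>. g \<tau> \<in> P \<and> prefix \<sigma> \<tau> \<and> g (\<tau> @ [False]) \<in> P \<and> g (\<tau> @ [True]) \<in> P))" for P
    unfolding Sacks_tree_def using ne[of "g -` P"] by (auto simp: Bex_def)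
  moreover have "openin powerset_topology {P. g \<sigma> \<notin> P \<or>
     (\<exists>\<tau>. g \<tau> \<in> P \<and> prefix \<sigma> \<tau> \<and> g (\<tau> @ [False]) \<in> P \<and> g (\<tau> @ [True]) \<in> P)}" for \<sigma>
    by (intro openin_disj openin_not_mem openin_ex openin_conj openin_mem openin_const)
  ultimately show ?thesis
    by (simp add: gdelta_in_conj gdelta_in_tree gdelta_in_all open_imp_gdelta_in openin_mem)
qed

lemma Polish_space_Tree2: "Polish_space Tree2"
  unfolding Tree2_def
  using Polish_space_gdelta[OF Polish_space_powerset gdelta_in_tree[of "\<lambda>x. x"]] by simp

lemma analytic_contains_Sacks_tree:
  "analytic_in Tree2 {T. tree T \<and> (\<exists>S. Sacks_tree S \<and> S \<subseteq> T)}" (is "analytic_in _ ?A")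
proof -
  \<comment> \<open>The pair of a Sacks tree \<open>S\<close> and a tree \<open>T\<close> above it
    is coded as the disjoint sum \<open>S <+> T\<close>, so all pairs lie in the power set of one
    countable type.\<close>
  define W :: "(bool list + bool list) set set" where
    "W = {P. Sacks_tree (Inl -` P) \<and> tree (Inr -` P) \<and> (\<forall>\<sigma>. Inl \<sigma> \<notin> P \<or> Inr \<sigma> \<in> P)}"
  have "gdelta_in powerset_topology W"
    unfolding W_def
    by (intro gdelta_in_conj gdelta_in_Sacks_tree gdelta_in_tree gdelta_in_all open_imp_gdelta_in
        openin_disj openin_mem openin_not_mem) simp
  then have "Polish_space (subtopology powerset_topology W)"
    by (rule Polish_space_gdelta[OF Polish_space_powerset])
  moreover have "continuous_map (subtopology powerset_topology W) Tree2 (\<lambda>P. Inr -` P)"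
    unfolding Tree2_def
    by (auto simp: continuous_map_in_subtopology W_def continuous_map_mem
        intro!: continuous_map_from_subtopology continuous_map_into_powerset)
  ultimately have "analytic_in Tree2 ((\<lambda>P. Inr -` P) ` topspace (subtopology powerset_topology W))"
    by (rule analytic_inI)
  moreover have "(\<lambda>P. Inr -` P) ` W = ?A"
  proof (intro equalityI subsetI)
    fix T assume "T \<in> ?A"
    then obtain S where "tree T" "Sacks_tree S" "S \<subseteq> T" by blast
    moreover have "Inl -` (S <+> T) = S" "Inr -` (S <+> T) = T" by auto
    ultimately show "T \<in> (\<lambda>P. Inr -` P) ` W"
      by (intro image_eqI[of _ _ "S <+> T"]) (auto simp: W_def)
  qed (auto simp: W_def)
  ultimately show ?thesis by simp
qed

subsection \<open>Branches with infinitely many ones\<close>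

abbreviation count_ones :: "bool list \<Rightarrow> nat" where
  "count_ones s \<equiv> count_list s True"

text \<open>\<open>erase\<close> deletes the bit that follows each retained \<^term>\<open>True\<close>; \<open>pending\<close> says that
  the list ends in a retained \<^term>\<open>True\<close>, so that the next bit will be deleted.\<close>

definition erase_step :: "bool list \<times> bool \<Rightarrow> bool \<Rightarrow> bool list \<times> bool" where
  "erase_step = (\<lambda>(e, p) b. if p then (e, False) else (e @ [b], b))"

definition erase :: "bool list \<Rightarrow> bool list" where
  "erase s = fst (foldl erase_step ([], False) s)"

definition pending :: "bool list \<Rightarrow> bool" where
  "pending s = snd (foldl erase_step ([], False) s)"

lemma erase_Nil [simp]: "erase [] = []" and pending_Nil [simp]: "\<not> pending []"
  by (simp_all add: erase_def pending_def)

lemma erase_snoc [simp]: "erase (s @ [b]) = (if pending s then erase s else erase s @ [b])"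
  and pending_snoc [simp]: "pending (s @ [b]) \<longleftrightarrow> \<not> pending s \<and> b"
  by (simp_all add: erase_def pending_def erase_step_def split: prod.split)

lemma prefix_erase: "prefix s t \<Longrightarrow> prefix (erase s) (erase t)"
proof -
  have "prefix (erase s) (erase (s @ u))" for u
    by (induction u rule: rev_induct) (auto simp flip: append_assoc)
  then show "prefix s t \<Longrightarrow> prefix (erase s) (erase t)" by (auto simp: prefix_def)
qed

text \<open>A deleted \<open>True\<close> directly follows a retained one, so at most half of the
  ones are lost. The term \<open>of_bool (pending s)\<close> strengthens the induction: it reserves
  room for the bit about to be deleted.\<close>

lemma count_ones_erase: "count_ones s + of_bool (pending s) \<le> 2 * count_ones (erase s)"
  by (induction s rule: rev_induct) (auto split: if_splits)

section \<open>Initial segments of bit sequences\<close>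

definition seg :: "(nat \<Rightarrow> bool) \<Rightarrow> nat \<Rightarrow> bool list" where
  "seg x n = map x [0..<n]"

lemma seg_Suc [simp]: "seg x (Suc n) = seg x n @ [x n]"
  and seg_0 [simp]: "seg x 0 = []"
  and length_seg [simp]: "length (seg x n) = n"
  by (simp_all add: seg_def)

lemma nth_seg [simp]: "k < n \<Longrightarrow> seg x n ! k = x k"
  by (simp add: seg_def)

lemma take_seg: "k \<le> n \<Longrightarrow> take k (seg x n) = seg x k"
  by (simp add: seg_def take_map)

lemma prefix_seg: "prefix s (seg x n) \<Longrightarrow> s = seg x (length s)"
  by (metis length_seg prefix_length_le prefix_def append_eq_conv_conj take_seg)

text \<open>A pending node of the tree splits, because the next bit is deleted and either value
  leaves the erasure unchanged. As \<open>x\<close> has ones beyond every place, each node extends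
  to a pending one.\<close>

lemma Sacks_tree_erase_seg:
  assumes inf: "\<forall>m. \<exists>k\<ge>m. x k"
  shows "Sacks_tree {s. \<exists>n. erase s = seg x n}" (is "Sacks_tree ?S")
  unfolding Sacks_tree_def
proof (intro conjI ballI)
  show "tree ?S"
    unfolding tree_def
  proof (intro ballI allI impI)
    fix s t assume "s \<in> ?S" "prefix t s"
    then obtain n where "prefix (erase t) (seg x n)" using prefix_erase by force
    then show "t \<in> ?S" using prefix_seg by blast
  qed
  have "[] \<in> ?S" by (auto intro: exI[of _ 0])
  then show "?S \<noteq> {}" by blast
  \<comment> \<open>Append the bits of \<open>x\<close> from place \<open>n\<close> on. The
    induction is on the distance \<open>d\<close> to some one of \<open>x\<close>; an earlier one
    ends the search sooner.\<close>
  have ext: "\<exists>\<tau>\<in>?S. prefix s \<tau> \<and> pending \<tau>" if "erase s = seg x n" "\<not> pending s" "x (n + d)" for s n d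
    using that
  proof (induction d arbitrary: s n)
    case 0
    then have "s @ [True] \<in> ?S" by (auto intro!: exI[of _ "Suc n"])
    then show ?case using 0 by (intro bexI[of _ "s @ [True]"]) auto
  next
    case (Suc d)
    have e: "erase (s @ [x n]) = seg x (Suc n)" using Suc.prems by simp
    show ?case
    proof (cases "x n")
      case True
      then show ?thesis using e Suc.prems(2) by (intro bexI[of _ "s @ [x n]"] CollectI exI[of _ "Suc n"]) simp_all
    next
      case False
      then have "\<exists>\<tau>\<in>?S. prefix (s @ [x n]) \<tau> \<and> pending \<tau>"
        using e Suc.prems by (intro Suc.IH[of _ "Suc n"]) auto
      then show ?thesis by (meson append_prefixD)
    qed
  qed
  fix \<sigma> assume \<sigma>: "\<sigma> \<in> ?S"
  have "\<exists>\<tau>\<in>?S. prefix \<sigma> \<tau> \<and> pending \<tau>"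
  proof (cases "pending \<sigma>")
    case False
    obtain n where n: "erase \<sigma> = seg x n" using \<sigma> by blast
    obtain k where "k \<ge> n" "x k" using inf by blast
    then show ?thesis using ext[OF n False, of "k - n"] by simp
  qed (use \<sigma> in auto)
  then obtain \<tau> where "\<tau> \<in> ?S" "prefix \<sigma> \<tau>" "pending \<tau>" by blast
  then show "\<exists>\<tau>\<in>?S. prefix \<sigma> \<tau> \<and> \<tau> @ [False] \<in> ?S \<and> \<tau> @ [True] \<in> ?S"
    by (intro bexI[of _ \<tau>]) auto
qed

text \<open>The lists are nested and of unbounded length, so their union is an infinite sequence
  \<open>x\<close>. If \<open>x\<close> vanished from \<open>m\<close> on, no list in the chain
  could have more than \<open>m\<close> ones.\<close>

lemma branch_of_chain:
  assumes pre: "\<And>i. prefix (e i) (e (Suc i))" and unbounded: "\<And>n. \<exists>i. n \<le> count_ones (e i)"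
  shows "\<exists>x. (\<forall>m. \<exists>k\<ge>m. x k) \<and> (\<forall>n. \<exists>i. prefix (seg x n) (e i))"
proof -
  have mono: "prefix (e i) (e j)" if "i \<le> j" for i j
    by (rule prefix_order.lift_Suc_mono_le[of e, OF pre that])
  have len: "\<exists>i. n \<le> length (e i)" for n
    using unbounded by (meson count_le_length le_trans)
  then obtain I where I: "\<And>n. n \<le> length (e (I n))" by metis
  \<comment> \<open>The index \<open>I (Suc k)\<close> guarantees length at least
    \<open>k + 1\<close>, so entry \<open>k\<close> exists.\<close>
  define x where "x k = e (I (Suc k)) ! k" for k
  have nth: "s ! k = t ! k" if "prefix s t \<or> prefix t s" "k < length s" "k < length t" for s t :: "bool list" and k
    using that by (auto simp: prefix_def nth_append)
  have x: "e i ! k = x k" if "k < length (e i)" for i k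
    unfolding x_def
    by (rule nth) (use mono[of i "I (Suc k)"] mono[of "I (Suc k)" i] that I[of "Suc k"] in linarith)+
  have seg: "e i = seg x (length (e i))" for i
    by (rule nth_equalityI) (simp_all add: x)
  have "\<exists>k\<ge>m. x k" for m
  proof (rule ccontr)
    assume *: "\<not> (\<exists>k\<ge>m. x k)"
    have "count_ones (seg x n) \<le> m" if "n \<le> m" for n
      using count_le_length[of "seg x n" True] that by simp
    moreover have "count_ones (seg x (m + d)) \<le> m" for d
      using calculation[of m] * by (induction d) auto
    ultimately have bound: "count_ones (seg x n) \<le> m" for n
      by (cases n m rule: le_cases) (auto dest: le_Suc_ex)
    obtain i where "Suc m \<le> count_ones (e i)" using unbounded by blast
    then show False using seg[of i] bound[of "length (e i)"] by simp
  qed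
  moreover have "prefix (seg x n) (e (I n))" for n
    using seg[of "I n"] I[of n] by (metis take_is_prefix take_seg)
  ultimately show ?thesis by blast
qed

text \<open>This reduces containing a Sacks tree to having one suitable branch. A Sacks tree has a
  branch with infinitely many ones, and erasing keeps at least half of them; conversely, the lists
  that erase to initial segments of \<open>x\<close> form a Sacks tree.\<close>

lemma contains_Sacks_tree_iff:
  assumes T: "tree T"
  shows "(\<exists>S. Sacks_tree S \<and> S \<subseteq> {s. erase s \<in> T}) \<longleftrightarrow>
    (\<exists>x. (\<forall>m. \<exists>k\<ge>m. x k) \<and> (\<forall>n. seg x n \<in> T))" (is "?L \<longleftrightarrow> ?R")
proof
  assume ?L
  then obtain S where S: "Sacks_tree S" and sub: "S \<subseteq> {s. erase s \<in> T}" by blast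
  \<comment> \<open>Climb through \<open>S\<close>: go to a splitting node above the current one and
    take its \<open>True\<close> successor.\<close>
  have "\<exists>r. \<forall>i. r i \<in> S \<and> (prefix (r i) (r (Suc i)) \<and> count_ones (r i) < count_ones (r (Suc i)))"
  proof (rule dependent_nat_choice)
    show "\<exists>s. s \<in> S" using S by (auto simp: Sacks_tree_def)
    fix s assume "s \<in> S"
    then obtain t where "prefix s t" "t @ [True] \<in> S"
      using S unfolding Sacks_tree_def by blast
    then show "\<exists>t. t \<in> S \<and> prefix s t \<and> count_ones s < count_ones t"
      by (intro exI[of _ "t @ [True]"]) (auto simp: prefix_def)
  qed
  then obtain r where r: "\<And>i. r i \<in> S" "\<And>i. prefix (r i) (r (Suc i))"
    "\<And>i. count_ones (r i) < count_ones (r (Suc i))" by blast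
  have grow: "i \<le> count_ones (r i)" for i
    using r(3) by (induction i) (auto simp: Suc_le_eq intro: le_less_trans)
  then have "n \<le> count_ones (erase (r (2 * n)))" for n
    using count_ones_erase[of "r (2 * n)"] grow[of "2 * n"] by linarith
  then obtain x where x: "\<forall>m. \<exists>k\<ge>m. x k" "\<forall>n. \<exists>i. prefix (seg x n) (erase (r i))"
    using branch_of_chain[of "\<lambda>i. erase (r i)"] prefix_erase[OF r(2)] by blast
  then have "\<forall>n. seg x n \<in> T"
    using T r(1) sub unfolding tree_def by blast
  then show ?R using x(1) by blast
next
  assume ?R
  then obtain x where x: "\<forall>m. \<exists>k\<ge>m. x k" "\<forall>n. seg x n \<in> T" by blast
  have "{s. \<exists>n. erase s = seg x n} \<subseteq> {s. erase s \<in> T}" using x(2) by auto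
  then show ?L using Sacks_tree_erase_seg[OF x(1)] by blast
qed

subsection \<open>A closed scheme for an analytic set\<close>

lemma count_ones_seg: "count_ones (seg x n) = card {j. j < n \<and> x j}"
proof (induction n)
  case (Suc n)
  have "{j. j < Suc n \<and> x j} = (if x n then insert n {j. j < n \<and> x j} else {j. j < n \<and> x j})"
    by (auto simp: less_Suc_eq)
  then show ?case using Suc by simp
qed simp

text \<open>Choose places \<open>p 0 < p 1 < ...\<close> with \<open>P i (p i)\<close> and let
  \<open>x\<close> be the indicator of their range; exactly \<open>i\<close> ones precede
  \<open>p i\<close>. Applied below to "\<open>q k\<close> is within \<open>(1/2)^i\<close> of
  \<open>z\<close>", it yields a code of \<open>z\<close>.\<close>

lemma ex_slow_branch:
  assumes "\<And>i m. \<exists>k\<ge>m. P i k"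
  shows "\<exists>x. (\<forall>m. \<exists>k\<ge>m. x k) \<and> (\<forall>k. x k \<longrightarrow> P (count_ones (seg x k)) k)"
proof -
  obtain p :: "nat \<Rightarrow> nat" where p: "\<And>i. P i (p i)" "\<And>i. p i < p (Suc i)"
    using dependent_nat_choice[of P "\<lambda>_ k l. k < l"] assms by (metis Suc_le_lessD)
  have sm: "strict_mono p" using p(2) by (simp add: strict_mono_Suc_iff)
  have "count_ones (seg (\<lambda>k. k \<in> range p) (p i)) = i" for i
  proof -
    have "{j. j < p i \<and> j \<in> range p} = p ` {..<i}"
      using strict_mono_less[OF sm] by auto
    then show ?thesis
      using sm by (simp add: count_ones_seg card_image strict_mono_imp_inj_on)
  qed
  then show ?thesis
    using p(1) strict_mono_imp_increasing[OF sm] by (intro exI[of _ "\<lambda>k. k \<in> range p"]) auto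
qed

text \<open>Used to find a place of a code whose tolerance
  \<open>(1/2) ^ count_ones (seg x k)\<close> is as small as desired.\<close>

lemma ex_count_ones_seg:
  assumes "\<forall>m. \<exists>k\<ge>m. x k"
  shows "\<exists>k. x k \<and> i \<le> count_ones (seg x k)"
proof (induction i)
  case (Suc i)
  then obtain k where k: "x k" "i \<le> count_ones (seg x k)" by blast
  obtain l where l: "l \<ge> Suc k" "x l" using assms by blast
  have "Suc (count_ones (seg x k)) = count_ones (seg x (Suc k))" using k by simp
  also have "\<dots> \<le> count_ones (seg x l)"
    using l unfolding count_ones_seg by (intro card_mono) auto
  finally show ?case using l k by auto
qed (use assms in auto)

text \<open>A point \<open>z\<close> with \<open>f z = y\<close> has a code, which is the required
  branch. Conversely, a branch gives points \<open>z n\<close> that satisfy ever more constraints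
  and whose images tend to \<open>y\<close>; the constraints make them Cauchy, and their limit is
  mapped to \<open>y\<close> by continuity.\<close>

lemma analytic_scheme:
  fixes Y :: "'b topology" and Z :: "'c topology"
  assumes Y: "metrizable_space Y" and Z: "Polish_space Z" and f: "continuous_map Z Y f"
  shows "\<exists>F :: bool list \<Rightarrow> 'b set. (\<forall>s. closedin Y (F s)) \<and>
    (\<forall>s t. prefix s t \<longrightarrow> F t \<subseteq> F s) \<and>
    (\<forall>y \<in> topspace Y. y \<in> f ` topspace Z \<longleftrightarrow>
       (\<exists>x. (\<forall>m. \<exists>k\<ge>m. x k) \<and> (\<forall>n. y \<in> F (seg x n))))"
proof -
  obtain M d where M: "Metric_space M d" "Metric_space.mcomplete M d" "Z = Metric_space.mtopology M d"
    using Z by (auto simp: Polish_space_def completely_metrizable_space_def)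
  obtain M' d' where M': "Metric_space M' d'" "Y = Metric_space.mtopology M' d'"
    using Y by (auto simp: metrizable_space_def)
  interpret Z: Metric_space M d by fact
  interpret Y: Metric_space M' d' by fact
  have fM: "f z \<in> M'" if "z \<in> M" for z
    using f that M(3) M'(2) by (auto simp: continuous_map_def)
  obtain D where D: "countable D" "D \<subseteq> M" "Z.mtopology closure_of D = M"
    using Z second_countable_imp_separable_space[of Z] M(3)
    by (auto simp: Polish_space_def separable_space_def)
  \<comment> \<open>Ignoring the second component of the decoded pair repeats every point of
    \<open>D\<close> at infinitely many indices. If \<open>D\<close> is empty the values are
    unspecified, so \<open>qM\<close> assumes a point of \<open>M\<close>.\<close>
  define q where "q k = from_nat_into D (fst (prod_decode k))" for k
  have ne: "D \<noteq> {}" if "z \<in> M" for z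
    using D(3) that by auto
  have qM: "q k \<in> M" if "z \<in> M" for z k
    using from_nat_into[OF ne[OF that]] D(2) by (auto simp: q_def)
  have q: "\<exists>k\<ge>m. d z (q k) \<le> (1/2)^i" if z: "z \<in> M" for z and i m :: nat
  proof -
    have "\<forall>r>0. \<exists>a\<in>D. a \<in> Z.mball z r"
      using D(3) z unfolding Z.metric_closure_of by blast
    then obtain a where a: "a \<in> D" "a \<in> Z.mball z ((1/2)^i)"
      by (meson half_gt_zero_iff zero_less_one zero_less_power)
    obtain j where j: "from_nat_into D j = a"
      using a(1) D(1) from_nat_into_to_nat_on by metis
    have "m \<le> prod_encode (j, m)" by (rule le_prod_encode_2)
    moreover have "q (prod_encode (j, m)) = a" by (simp add: q_def j)
    ultimately show ?thesis using a(2) by (intro exI[of _ "prod_encode (j, m)"]) auto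
  qed
  \<comment> \<open>The exponent counts the ones strictly before place \<open>k\<close>, so the ones
    of \<open>s\<close> carry the tolerances 1, 1/2, 1/4 and so on.\<close>
  define C where "C s = {z \<in> M. \<forall>k < length s. s ! k \<longrightarrow> d z (q k) \<le> (1/2) ^ count_ones (take k s)}" for s
  define F where "F s = Y closure_of (f ` C s)" for s
  have Cmono: "C t \<subseteq> C s" if st: "prefix s t" for s t
  proof
    fix z assume z: "z \<in> C t"
    obtain u where u: "t = s @ u" using st by (auto simp: prefix_def)
    have "d z (q k) \<le> (1/2) ^ count_ones (take k s)" if "k < length s" "s ! k" for k
    proof -
      have "t ! k" "take k t = take k s" "k < length t" using that by (simp_all add: u nth_append)
      then show ?thesis using z unfolding C_def by auto
    qed
    then show "z \<in> C s" using z by (simp add: C_def)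
  qed
  have "y \<in> f ` topspace Z \<longleftrightarrow>
       (\<exists>x. (\<forall>m. \<exists>k\<ge>m. x k) \<and> (\<forall>n. y \<in> F (seg x n)))" (is "?L \<longleftrightarrow> ?R") if y: "y \<in> topspace Y" for y
  proof
    assume ?L
    then obtain z where z: "z \<in> M" "y = f z" using M(3) by auto
    obtain x where x: "\<forall>m. \<exists>k\<ge>m. x k" "\<forall>k. x k \<longrightarrow> d z (q k) \<le> (1/2) ^ count_ones (seg x k)"
      using ex_slow_branch[of "\<lambda>i k. d z (q k) \<le> (1/2)^i", OF q[OF z(1)]] by auto
    have "z \<in> C (seg x n)" for n
      using z(1) x(2) by (simp add: C_def take_seg)
    then have "y \<in> F (seg x n)" for n
      unfolding F_def using closure_of_subset_Int[of Y "f ` C (seg x n)"] y z(2) by blast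
    then show ?R using x(1) by blast
  next
    assume ?R
    then obtain x where x: "\<forall>m. \<exists>k\<ge>m. x k" "\<And>n. y \<in> F (seg x n)" by blast
    \<comment> \<open>Membership of \<open>y\<close> in the closure \<open>F (seg x n)\<close> gives
      only approximate preimages, one for each \<open>n\<close>.\<close>
    have "\<exists>z \<in> C (seg x n). d' (f z) y < 1 / Suc n" for n
    proof -
      have "y \<in> Y.mtopology closure_of (f ` C (seg x n))" using x(2)[of n] M'(2) by (simp add: F_def)
      then have "\<forall>r>0. \<exists>v\<in>f ` C (seg x n). v \<in> Y.mball y r"
        unfolding Y.metric_closure_of by blast
      then obtain v where "v \<in> f ` C (seg x n)" "v \<in> Y.mball y (1 / Suc n)"
        by (meson of_nat_0_less_iff zero_less_Suc zero_less_divide_1_iff)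
      then show ?thesis by (auto simp: Y.commute)
    qed
    then obtain z where z: "\<And>n. z n \<in> C (seg x n)" "\<And>n. d' (f (z n)) y < 1 / Suc n" by metis
    have zM: "z n \<in> M" for n using z(1)[of n] by (simp add: C_def)
    have "Z.MCauchy z"
      unfolding Z.MCauchy_def
    proof (intro conjI allI impI)
      show "range z \<subseteq> M" using zM by auto
      fix \<epsilon> :: real assume "\<epsilon> > 0"
      then obtain i where i: "(1/2)^i < \<epsilon>/2"
        using real_arch_pow_inv[of "\<epsilon>/2" "1/2"] by auto
      obtain k where k: "x k" "i \<le> count_ones (seg x k)" using ex_count_ones_seg[OF x(1)] by blast
      \<comment> \<open>Place \<open>k\<close> belongs to \<open>seg x n\<close> once
        \<open>n > k\<close>, so all these points obey the same constraint and lie near the single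
        centre \<open>q k\<close>.\<close>
      have *: "d (z n) (q k) < \<epsilon>/2" if "Suc k \<le> n" for n
      proof -
        have "d (z n) (q k) \<le> (1/2) ^ count_ones (seg x k)"
          using z(1)[of n] that k(1) by (auto simp: C_def take_seg)
        also have "\<dots> \<le> (1/2)^i" using k(2) by (intro power_decreasing) auto
        finally show ?thesis using i by simp
      qed
      show "\<exists>N. \<forall>n n'. N \<le> n \<longrightarrow> N \<le> n' \<longrightarrow> d (z n) (z n') < \<epsilon>"
      proof (intro exI allI impI)
        fix n n' assume "Suc k \<le> n" "Suc k \<le> n'"
        then show "d (z n) (z n') < \<epsilon>"
          using *[of n] *[of n'] Z.triangle'[OF zM[of n] qM[OF zM, of k] zM[of n']] by simp
      qed
    qed
    then obtain w where w: "limitin Z z w sequentially"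
      using M(2,3) unfolding Z.mcomplete_def by blast
    have "limitin Y (f \<circ> z) (f w) sequentially"
      by (rule continuous_map_limit[OF f w])
    moreover have "limitin Y (f \<circ> z) y sequentially"
      unfolding M'(2) Y.limitin_metric_dist_null
    proof (intro conjI)
      show "y \<in> M'" using y M'(2) by simp
      show "\<forall>\<^sub>F n in sequentially. (f \<circ> z) n \<in> M'" using fM zM by simp
      show "(\<lambda>n. d' ((f \<circ> z) n) y) \<longlonglongrightarrow> 0"
        by (rule tendsto_sandwich[OF _ _ tendsto_const LIMSEQ_Suc[OF lim_1_over_n]])
          (use z(2) in \<open>auto simp: less_imp_le intro!: always_eventually\<close>)
    qed
    ultimately have "f w = y"
      unfolding M'(2) by (rule Y.limitin_metric_unique) simp
    then show ?L using w by (auto simp: limitin_def)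
  qed
  moreover have "closedin Y (F s)" for s by (simp add: F_def)
  moreover have "F t \<subseteq> F s" if "prefix s t" for s t
    unfolding F_def by (intro closure_of_mono image_mono Cmono that)
  ultimately show ?thesis by (intro exI[of _ F]) simp
qed

subsection \<open>The reduction\<close>

lemma space_borel_algebra [simp]: "space (borel_algebra X) = topspace X"
  by (simp add: borel_algebra_def space_measure_of_conv)

lemma openin_imp_borel: "openin X U \<Longrightarrow> U \<in> sets (borel_algebra X)"
  unfolding borel_algebra_def using openin_subset by (subst sets_measure_of) auto

lemma closedin_imp_borel:
  assumes "closedin X C"
  shows "C \<in> sets (borel_algebra X)"
proof -
  have "topspace X - (topspace X - C) \<in> sets (borel_algebra X)"
    using assms by (metis closedin_def openin_imp_borel sets.compl_sets space_borel_algebra)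
  then show ?thesis using closedin_subset[OF assms] by (simp add: double_diff)
qed

text \<open>An open set is a countable union of cylinders, and the preimage of a cylinder is a
  finite Boolean combination of the sets in \<open>mem\<close>.\<close>

lemma measurable_into_Tree2:
  assumes tree: "\<And>y. y \<in> topspace Y \<Longrightarrow> tree (g y)"
    and mem: "\<And>\<sigma>. {y \<in> topspace Y. \<sigma> \<in> g y} \<in> sets (borel_algebra Y)"
  shows "g \<in> measurable (borel_algebra Y) (borel_algebra Tree2)"
  unfolding borel_algebra_def[of Tree2]
proof (rule measurable_measure_of)
  show "{U. openin Tree2 U} \<subseteq> Pow (topspace Tree2)" using openin_subset by blast
  show "g \<in> space (borel_algebra Y) \<rightarrow> topspace Tree2" using tree by (simp add: topspace_Tree2)
  have cyl: "{y \<in> topspace Y. g y \<inter> D = E} \<in> sets (borel_algebra Y)" if "finite D" for D E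
  proof (cases "E \<subseteq> D")
    case True
    have not_mem: "{y \<in> topspace Y. \<sigma> \<notin> g y} \<in> sets (borel_algebra Y)" for \<sigma>
    proof -
      have "{y \<in> topspace Y. \<sigma> \<notin> g y} = space (borel_algebra Y) - {y \<in> topspace Y. \<sigma> \<in> g y}" by auto
      then show ?thesis using sets.compl_sets[OF mem] by simp
    qed
    have "{y \<in> space (borel_algebra Y). \<forall>\<sigma>\<in>D. \<sigma> \<in> g y \<longleftrightarrow> \<sigma> \<in> E} \<in> sets (borel_algebra Y)"
    proof (rule sets.sets_Collect_finite_All[OF _ that])
      show "{y \<in> space (borel_algebra Y). \<sigma> \<in> g y \<longleftrightarrow> \<sigma> \<in> E} \<in> sets (borel_algebra Y)" for \<sigma>
        using mem not_mem by (cases "\<sigma> \<in> E") auto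
    qed
    moreover have "g y \<inter> D = E \<longleftrightarrow> (\<forall>\<sigma>\<in>D. \<sigma> \<in> g y \<longleftrightarrow> \<sigma> \<in> E)" for y
      using True by blast
    ultimately show ?thesis by simp
  next
    case False
    then have "{y \<in> topspace Y. g y \<inter> D = E} = {}" by blast
    then show ?thesis by (simp only: sets.empty_sets)
  qed
  fix V assume "V \<in> {U. openin Tree2 U}"
  then obtain U where U: "openin powerset_topology U" and V: "V = U \<inter> {T. tree T}"
    by (auto simp: Tree2_def openin_subtopology)
  \<comment> \<open>Finiteness of \<open>E\<close> keeps \<open>K\<close> countable; it holds for
    the traces \<open>g y \<inter> D\<close> that arise.\<close>
  define K where "K = {(D, E). finite D \<and> finite E \<and> {T. T \<inter> D = E} \<subseteq> U}"
  have "g -` V \<inter> topspace Y = (\<Union>(D, E)\<in>K. {y \<in> topspace Y. g y \<inter> D = E})"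
  proof (intro equalityI subsetI)
    fix y assume y: "y \<in> g -` V \<inter> topspace Y"
    then obtain D where "finite D" "{T. T \<inter> D = g y \<inter> D} \<subseteq> U"
      using U V cylinder_in_open by (metis IntD1 vimage_eq)
    then have "(D, g y \<inter> D) \<in> K" by (auto simp: K_def)
    then show "y \<in> (\<Union>(D, E)\<in>K. {y \<in> topspace Y. g y \<inter> D = E})" using y by blast
  qed (use tree V in \<open>auto simp: K_def\<close>)
  moreover have "countable K"
  proof (rule countable_subset)
    show "K \<subseteq> {D. finite D} \<times> {E. finite E}" by (auto simp: K_def)
    show "countable ({D::bool list set. finite D} \<times> {E::bool list set. finite E})"
      by (intro countable_SIGMA countable_Collect_finite)
  qed
  ultimately show "g -` V \<inter> space (borel_algebra Y) \<in> sets (borel_algebra Y)"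
    using cyl by (auto simp: K_def intro!: sets.countable_UN')
qed

lemma Borel_reducible_contains_Sacks_tree:
  assumes Y: "Polish_space Y" and B: "analytic_in Y B"
  shows "Borel_reducible Y B Tree2 {T. tree T \<and> (\<exists>S. Sacks_tree S \<and> S \<subseteq> T)}"
proof -
  obtain Z :: "(nat \<Rightarrow> nat) topology" and f
    where Z: "Polish_space Z" and f: "continuous_map Z Y f" and B_eq: "f ` topspace Z = B"
    using B unfolding analytic_in_def by blast
  have "metrizable_space Y"
    using Y by (simp add: Polish_space_def completely_metrizable_imp_metrizable_space)
  then obtain F :: "bool list \<Rightarrow> 'a set" where closed: "\<And>s. closedin Y (F s)"
    and mono: "\<And>s t. prefix s t \<Longrightarrow> F t \<subseteq> F s"
    and F: "\<And>y. y \<in> topspace Y \<Longrightarrow>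
      y \<in> B \<longleftrightarrow> (\<exists>x. (\<forall>m. \<exists>k\<ge>m. x k) \<and> (\<forall>n. y \<in> F (seg x n)))"
    using analytic_scheme[OF _ Z f] unfolding B_eq by blast
  \<comment> \<open>The section of the scheme at \<open>y\<close> with a free bit inserted after
    each one, in the form of \<open>contains_Sacks_tree_iff\<close>. Borel measurability follows
    since \<sigma> lies in \<open>g y\<close> exactly when \<open>y\<close> lies in the closed set
    \<open>F (erase \<sigma>)\<close>.\<close>
  define g where "g y = {s. erase s \<in> {t. y \<in> F t}}" for y
  have tree: "tree {t. y \<in> F t}" "tree (g y)" for y
    using mono prefix_erase unfolding tree_def g_def by blast+
  have "g \<in> measurable (borel_algebra Y) (borel_algebra Tree2)"
  proof (rule measurable_into_Tree2)
    fix \<sigma>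
    have "{y \<in> topspace Y. \<sigma> \<in> g y} = F (erase \<sigma>)"
      using closedin_subset[OF closed] by (auto simp: g_def)
    then show "{y \<in> topspace Y. \<sigma> \<in> g y} \<in> sets (borel_algebra Y)"
      using closed by (simp add: closedin_imp_borel)
  qed (rule tree)
  moreover have "g -` {T. tree T \<and> (\<exists>S. Sacks_tree S \<and> S \<subseteq> T)} \<inter> topspace Y = B"
  proof -
    have "(\<exists>S. Sacks_tree S \<and> S \<subseteq> g y) \<longleftrightarrow> y \<in> B" if "y \<in> topspace Y" for y
      using contains_Sacks_tree_iff[OF tree(1)[of y]] F[OF that] unfolding g_def by simp
    moreover have "B \<subseteq> topspace Y"
      using f B_eq by (auto simp: continuous_map_def)
    ultimately show ?thesis using tree(2) by auto
  qed
  ultimately show ?thesis unfolding Borel_reducible_def by blast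
qed

theorem theorem3p7:
  shows "Sigma11_complete TYPE('b) Tree2 {T. tree T \<and> (\<exists>S. Sacks_tree S \<and> S \<subseteq> T)}"
  unfolding Sigma11_complete_def
  using Polish_space_Tree2 analytic_contains_Sacks_tree Borel_reducible_contains_Sacks_tree by blast

end
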